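(* Let $N\ge 2$, let $\mathbb{D}$ be a division ring, and let $r_1,\dots,r_K:\mathbb{Z}^N\to\mathbb{D}^\times$ be a solution of the lattice modified Gel'fand--Dikii system $$(r_{k(j)}^{-1}-r_{k(i)}^{-1})\,r_{k(ij)} = r_{k+1}^{-1}\,(r_{k+1(i)}-r_{k+1(j)}),\qquad k=1,\dots,K,\quad 1\le i\neq j\le N,$$ with the index $k$ taken modulo $K$ (so $r_{K+1}=r_1$). If $\mathbb{D}$ is commutative, then the function $R=r_1r_2\cdots r_K$ splits into a product of functions of the single variables $n_i$, $i=1,\dots,N$: there exist functions $R_1,\dots,R_N:\mathbb{Z}\to\mathbb{D}^\times$ such that $R(n_1,\dots,n_N)=R_1(n_1)R_2(n_2)\cdots R_N(n_N)$ for all $(n_1,\dots,n_N)\in\mathbb{Z}^N$.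
   Context: For a function $f$ on $\mathbb{Z}^N$, $f_{(i)}$ denotes its translate in the variable $n_i\mapsto n_i+1$, and $f_{(ij)}=(f_{(i)})_{(j)}$. $\mathbb{D}^\times=\mathbb{D}\setminus\{0\}$.
   Formalization: The formal theorem also assumes that r_{k(i)} ≠ r_{k(j)} at every lattice point for all k and all i ≠ j; without this the claim fails, since for K = 1 any nowhere-zero function of n_1+…+n_N solves the system as 0 = 0 and need not split. *)

theory Defs
  imports "HOL-Analysis.Finite_Cartesian_Product"
begin

text \<open>Functions on \<open>\<int>\<^sup>N\<close> are functions on \<^typ>\<open>int ^ 'n\<close>, with \<open>N = CARD('n)\<close>.\<close>

definition shift :: "'n::finite \<Rightarrow> (int ^ 'n \<Rightarrow> 'd) \<Rightarrow> int ^ 'n \<Rightarrow> 'd"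
  where "shift i f n = f (n + axis i 1)"

text \<open>
  The unknowns are \<open>r 1, \<dots>, r K\<close>; values of \<open>r\<close> at other indices play no role. The cyclic
  successor of \<open>k\<close> in \<open>{1..K}\<close> is \<open>k mod K + 1\<close>. The order of the factors is the one used over
  a general, not necessarily commutative, division ring.
\<close>

definition lattice_mGD ::
    "nat \<Rightarrow> (nat \<Rightarrow> int ^ 'n::finite \<Rightarrow> 'd::division_ring) \<Rightarrow> bool"
  where "lattice_mGD K r \<longleftrightarrow>
    (\<forall>k\<in>{1..K}. \<forall>n. r k n \<noteq> 0) \<and>
    (\<forall>k\<in>{1..K}. \<forall>i j n. i \<noteq> j \<longrightarrow>
      (inverse (shift j (r k) n) - inverse (shift i (r k) n)) * shift i (shift j (r k)) n =
      inverse (r (k mod K + 1) n) *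
        (shift i (r (k mod K + 1)) n - shift j (r (k mod K + 1)) n))"

text \<open>
  Genericity: the coefficient \<open>r\<^bsub>k(j)\<^esub>\<^sup>-\<^sup>1 - r\<^bsub>k(i)\<^esub>\<^sup>-\<^sup>1\<close> of \<open>r\<^bsub>k(ij)\<^esub>\<close> never vanishes, so that the
  system determines \<open>r\<^bsub>k(ij)\<^esub>\<close>. Where it vanishes for one \<open>k\<close>, the system makes it vanish for
  all \<open>k\<close> and leaves \<open>r\<^bsub>k(ij)\<^esub>\<close> unconstrained.
\<close>

definition nondegenerate ::
    "nat \<Rightarrow> (nat \<Rightarrow> int ^ 'n::finite \<Rightarrow> 'd::division_ring) \<Rightarrow> bool"
  where "nondegenerate K r \<longleftrightarrow>
    (\<forall>k\<in>{1..K}. \<forall>i j n. i \<noteq> j \<longrightarrow> shift i (r k) n \<noteq> shift j (r k) n)"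

text \<open>
  Without genericity the product of the unknowns need not split: every nowhere vanishing
  function of \<open>n\<^sub>1 + \<dots> + n\<^sub>N\<close> solves the system with \<open>K = 1\<close>.
\<close>

lemma degenerate_solution_not_split:
  "\<exists>r :: nat \<Rightarrow> int ^ bool \<Rightarrow> rat. lattice_mGD 1 r \<and>
     \<not> (\<exists>R. \<forall>n. (\<Prod>k=1..1. r k n) = (\<Prod>i\<in>UNIV. R i (n $ i)))"
proof -
  define r :: "nat \<Rightarrow> int ^ bool \<Rightarrow> rat"
    where "r k n = (if n $ True + n $ False = 0 then 2 else 1)" for k n
  have "shift i (r k) n = shift j (r k) n" for i j k n
    by (cases i; cases j) (simp_all add: shift_def r_def axis_def algebra_simps)
  then have "lattice_mGD 1 r"
    unfolding lattice_mGD_def by (metis (no_types, lifting) diff_self mult_zero_left mult_zero_right r_def zero_neq_numeral zero_neq_one)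
  moreover have False if R: "\<forall>n. (\<Prod>k=1..1. r k n) = (\<Prod>i\<in>UNIV. R i (n $ i))" for R
  proof -
    have R': "R True a * R False b = (if a + b = 0 then 2 else 1)" for a b
      using R[rule_format, of "\<chi> i. if i then a else b"]
      by (simp add: r_def UNIV_bool mult.commute)
    have "(R True 0 * R False 0) * (R True 1 * R False (-1)) =
        (R True 0 * R False (-1)) * (R True 1 * R False 0)"
      by (simp only: ac_simps)
    then show False
      unfolding R' by simp
  qed
  ultimately show ?thesis
    by blast
qed

end

theory Submission
  imports Defs
begin

text \<open>
  Multiply the \<open>K\<close> equations at a fixed lattice point. The nonzero differences
  \<open>r\<^bsub>k(i)\<^esub> - r\<^bsub>k(j)\<^esub>\<close> cancel cyclically and leave \<open>R R\<^bsub>(ij)\<^esub> = R\<^bsub>(i)\<^esub> R\<^bsub>(j)\<^esub>\<close> for the product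
  \<open>R\<close> of the \<open>r\<^sub>k\<close>. So the ratio \<open>R\<^bsub>(i)\<^esub> / R\<close> depends on \<open>n\<^sub>i\<close> only, and dividing \<open>R\<close> by the
  product of its restrictions to the coordinate axes gives a constant.
\<close>

lemma shift_invariant_axis:
  fixes f :: "int ^ 'n::finite \<Rightarrow> 'a"
  assumes "\<And>x. f (x + axis j 1) = f x"
  shows "f (x + axis j a) = f x"
proof (induction a rule: int_induct[where k = 0])
  case base
  have "x + axis j 0 = x"
    by (simp add: vec_eq_iff axis_def)
  then show ?case by (simp only:)
next
  case (step1 a)
  have "x + axis j (a + 1) = x + axis j a + axis j 1"
    by (simp add: vec_eq_iff axis_def)
  then show ?case using assms step1 by (simp only:)
next
  \<comment> \<open>The hypothesis holds at every point, so used at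
    \<open>x + axis j (a - 1)\<close> it also gives the step downwards.\<close>
  case (step2 a)
  have "x + axis j a = x + axis j (a - 1) + axis j 1"
    by (simp add: vec_eq_iff axis_def)
  then show ?case using assms[of "x + axis j (a - 1)"] step2 by (simp only:)
qed

text \<open>Only coordinates in \<open>S\<close> have to change between \<open>x\<close> and
  \<open>y\<close>, one axis displacement at a time. With \<open>S = - {i}\<close> this yields
  dependence on coordinate \<open>i\<close> alone, with \<open>S = UNIV\<close> constancy.\<close>

lemma shift_invariant_eq:
  fixes f :: "int ^ 'n::finite \<Rightarrow> 'a"
  assumes inv: "\<And>j x. j \<in> S \<Longrightarrow> f (x + axis j 1) = f x"
    and eq: "\<And>j. j \<notin> S \<Longrightarrow> x $ j = y $ j"
  shows "f x = f y"
proof -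
  have sum_inv: "f (x + (\<Sum>j\<in>T. axis j (v j))) = f x" if "T \<subseteq> S" for T v
    using finite[of T] that
  proof (induction T rule: finite_induct)
    case empty
    show ?case by simp
  next
    case (insert j T)
    have "x + (\<Sum>k\<in>insert j T. axis k (v k)) = (x + (\<Sum>k\<in>T. axis k (v k))) + axis j (v j)"
      using insert.hyps by (simp add: add_ac)
    then have "f (x + (\<Sum>k\<in>insert j T. axis k (v k))) = f (x + (\<Sum>k\<in>T. axis k (v k)))"
      using insert.prems by (simp only:) (rule shift_invariant_axis, rule inv, simp)
    also have "\<dots> = f x"
      using insert.IH insert.prems by blast
    finally show ?case .
  qed
  have "y = x + (\<Sum>j\<in>S. axis j (y $ j - x $ j))"
    using eq by (auto simp: vec_eq_iff axis_def sum.delta)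
  then have "f y = f (x + (\<Sum>j\<in>S. axis j (y $ j - x $ j)))"
    by (rule arg_cong)
  also have "\<dots> = f x"
    by (rule sum_inv) simp
  finally show ?thesis ..
qed

lemma splits_into_single_variable_factors:
  fixes F :: "int ^ 'n::finite \<Rightarrow> 'd::field"
  assumes nz: "\<And>n. F n \<noteq> 0"
    and rel: "\<And>i j n. i \<noteq> j \<Longrightarrow>
      F n * F (n + axis i 1 + axis j 1) = F (n + axis i 1) * F (n + axis j 1)"
  shows "\<exists>R :: 'n \<Rightarrow> int \<Rightarrow> 'd. (\<forall>i m. R i m \<noteq> 0) \<and> (\<forall>n. F n = (\<Prod>i\<in>UNIV. R i (n $ i)))"
proof -
  define G where "G i m = F (axis i m)" for i m
  define W where "W n = F n / (\<Prod>i\<in>UNIV. G i (n $ i))" for n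
  have G_nz: "G i m \<noteq> 0" for i m
    by (simp add: G_def nz)
  have ratio: "F (n + axis i 1) / F n = G i (n $ i + 1) / G i (n $ i)" for i n
  proof -
    \<comment> \<open>Divided by \<open>F x * F (x + axis j 1)\<close>, the relation says that the
      ratio is invariant in every direction \<open>j\<close> other than \<open>i\<close>. Hence
      \<open>n\<close> may be replaced by its projection to the \<open>i\<close>-th axis.\<close>
    have "F (n + axis i 1) / F n = F (axis i (n $ i) + axis i 1) / F (axis i (n $ i))"
    proof (rule shift_invariant_eq[where S = "- {i}" and f = "\<lambda>n. F (n + axis i 1) / F n"])
      fix j and x :: "int ^ 'n"
      assume "j \<in> - {i}"
      then have "F x * F (x + axis j 1 + axis i 1) = F (x + axis j 1) * F (x + axis i 1)"
        by (intro rel) auto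
      then show "F (x + axis j 1 + axis i 1) / F (x + axis j 1) = F (x + axis i 1) / F x"
        by (simp add: nz frac_eq_eq mult.commute)
    qed (simp add: axis_def)
    moreover have "axis i (n $ i) + axis i 1 = axis i (n $ i + 1)"
      by (simp add: vec_eq_iff axis_def)
    ultimately show ?thesis by (simp add: G_def)
  qed
  have "W (n + axis i 1) = W n" for i n
  proof -
    \<comment> \<open>A shift in direction \<open>i\<close> changes only the \<open>i\<close>-th
      factor of the denominator, and by \<open>ratio\<close> that factor changes in the same
      proportion as \<open>F\<close>.\<close>
    have prod_eq: "(\<Prod>j\<in>UNIV. G j (m $ j)) = G i (m $ i) * (\<Prod>j\<in>UNIV - {i}. G j (m $ j))" for m
      by (simp add: prod.remove)
    have rest: "(\<Prod>j\<in>UNIV - {i}. G j ((n + axis i 1) $ j)) = (\<Prod>j\<in>UNIV - {i}. G j (n $ j))"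
      by (rule prod.cong) (auto simp: axis_def)
    have "F (n + axis i 1) * G i (n $ i) = F n * G i (n $ i + 1)"
      using ratio[of n i] by (simp add: nz G_nz frac_eq_eq mult.commute)
    then show ?thesis
      unfolding W_def prod_eq rest by (simp add: G_nz axis_def frac_eq_eq)
  qed
  then have W_const: "W n = W 0" for n
    by (rule shift_invariant_eq[where S = UNIV]) auto
  have F_eq: "F n = W 0 * (\<Prod>i\<in>UNIV. G i (n $ i))" for n
    unfolding W_const[of n, symmetric] by (simp add: W_def G_nz)
  have W0_nz: "W 0 \<noteq> 0"
    by (simp add: W_def nz G_nz)
  \<comment> \<open>All axes meet at the origin, so \<open>W 0\<close> is \<open>F 0\<close> to the
    power 1 - N and need not be 1. It is absorbed into the factor of one arbitrary index
    \<open>i0\<close>.\<close>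
  obtain i0 :: 'n where True by simp
  define R where "R i m = (if i = i0 then W 0 else 1) * G i m" for i m
  have "F n = (\<Prod>i\<in>UNIV. R i (n $ i))" for n
    by (simp add: R_def F_eq prod.distrib)
  moreover have "R i m \<noteq> 0" for i m
    by (simp add: R_def W0_nz G_nz)
  ultimately show ?thesis by blast
qed

text \<open>The cyclic successor permutes \<open>{1..K}\<close>; its inverse sends 1 to
  \<open>K\<close> and lowers every other index by 1.\<close>

lemma prod_cyclic_successor:
  fixes f :: "nat \<Rightarrow> 'a::comm_monoid_mult"
  shows "(\<Prod>k=1..K. f (k mod K + 1)) = (\<Prod>k=1..K. f k)"
proof (rule prod.reindex_bij_witness[where j = "\<lambda>k. k mod K + 1"
      and i = "\<lambda>k. if k = 1 then K else k - 1"])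
  fix k
  assume "k \<in> {1..K}"
  then show "(if k mod K + 1 = 1 then K else k mod K + 1 - 1) = k" and "k mod K + 1 \<in> {1..K}"
    by (cases "k = K"; simp)+
qed auto

lemma lattice_mGD_prod_relation:
  fixes r :: "nat \<Rightarrow> int ^ 'n::finite \<Rightarrow> 'd::field"
  assumes sys: "lattice_mGD K r" and nondeg: "nondegenerate K r" and "i \<noteq> j"
  shows "(\<Prod>k=1..K. r k n) * (\<Prod>k=1..K. r k (n + axis i 1 + axis j 1)) =
    (\<Prod>k=1..K. r k (n + axis i 1)) * (\<Prod>k=1..K. r k (n + axis j 1))"
proof -
  define a where "a k = r k (n + axis i 1)" for k
  define b where "b k = r k (n + axis j 1)" for k
  define c where "c k = r k (n + axis i 1 + axis j 1)" for k
  have nz: "r k m \<noteq> 0" if "k \<in> {1..K}" for k m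
    using sys that by (auto simp: lattice_mGD_def)
  have ab: "a k - b k \<noteq> 0" if "k \<in> {1..K}" for k
    using nondeg that \<open>i \<noteq> j\<close> by (auto simp: nondegenerate_def shift_def a_def b_def)
  \<comment> \<open>Since 1/b - 1/a = (a - b)/(ab), this is the system with denominators
    cleared.\<close>
  have eqn: "((a k - b k) * c k) * r (k mod K + 1) n =
      (a (k mod K + 1) - b (k mod K + 1)) * (a k * b k)" if k: "k \<in> {1..K}" for k
  proof -
    have "k mod K + 1 \<in> {1..K}"
      using k by (cases "k = K") auto
    moreover have "(inverse (b k) - inverse (a k)) * c k =
        inverse (r (k mod K + 1) n) * (a (k mod K + 1) - b (k mod K + 1))"
      using sys k \<open>i \<noteq> j\<close> by (simp add: lattice_mGD_def shift_def a_def b_def c_def)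
    ultimately show ?thesis
      using nz[OF k] nz[of "k mod K + 1"] by (simp add: a_def b_def field_simps)
  qed
  have "(\<Prod>k=1..K. ((a k - b k) * c k) * r (k mod K + 1) n) =
      (\<Prod>k=1..K. (a (k mod K + 1) - b (k mod K + 1)) * (a k * b k))"
    by (rule prod.cong) (use eqn in auto)
  \<comment> \<open>After cyclic reindexing both sides carry the same product of differences, which
    nondegeneracy makes nonzero and hence cancellable.\<close>
  then have "(\<Prod>k=1..K. a k - b k) * ((\<Prod>k=1..K. r k n) * (\<Prod>k=1..K. c k)) =
      (\<Prod>k=1..K. a k - b k) * ((\<Prod>k=1..K. a k) * (\<Prod>k=1..K. b k))"
    unfolding prod.distrib prod_cyclic_successor[of "\<lambda>k. r k n"]
      prod_cyclic_successor[of "\<lambda>k. a k - b k"] by (simp only: ac_simps)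
  moreover have "(\<Prod>k=1..K. a k - b k) \<noteq> 0"
    using ab by (subst prod_zero_iff) auto
  ultimately show ?thesis
    by (simp add: a_def b_def c_def)
qed

theorem lemma2p1:
  fixes r :: "nat \<Rightarrow> int ^ 'n::finite \<Rightarrow> 'd::field"
    and K :: nat
  assumes "CARD('n) \<ge> 2"
    and "K \<ge> 1"
    and "lattice_mGD K r"
    and "nondegenerate K r"
  shows "\<exists>R :: 'n \<Rightarrow> int \<Rightarrow> 'd.
    (\<forall>i m. R i m \<noteq> 0) \<and> (\<forall>n. (\<Prod>k=1..K. r k n) = (\<Prod>i\<in>UNIV. R i (n $ i)))"
proof (rule splits_into_single_variable_factors)
  show "(\<Prod>k=1..K. r k n) \<noteq> 0" for n
    using assms(3) by (auto simp: lattice_mGD_def)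
qed (rule lattice_mGD_prod_relation[OF assms(3,4)])

end
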